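(* Let $V=E_1\oplus E_2$ be a decomposition with $E_1,E_2\neq\{0\}$, and let $\Omega_i\subset\mathbb{P}(E_i)$ ($i=1,2$) be properly convex domains. Let $\Omega$ be a join of $\Omega_1$ and $\Omega_2$. If $P\subset\Omega$ is a convex subset with nonempty interior such that $\Omega_1\cap\overline{P}$ has nonempty relative interior in $\Omega_1$, then $\mu_\Omega(P)=\infty$.
   Context: A properly convex domain of $\mathbb{P}(E)$ is an open subset that is the projectivization of an open convex cone of $E$ containing no full line. If $C_i\subset E_i$ are open convex cones lifting $\Omega_i$ with no full line, a join of $\Omega_1$ and $\Omega_2$ is a properly convex domain of $\mathbb{P}(E_1\oplus E_2)$ of the form $\mathbb{P}(C_1+C_2)$ (there are two such, according to the choice of signs of the lifts). $\mu_\Omega$ is the Busemann measure of $\Omega$, i.e. the $d$-dimensional Hausdorff measure of $(\Omega,d_\Omega)$ where $d=\dim\mathbb{P}(V)$ and $d_\Omega(x,y)=\tfrac12\log[x':x:y:y']$ is the Hilbert metric ($x',y'$ the endpoints in $\partial\Omega$ of the line through $x,y$, cross-ratio normalized by $[0:1:\lambda:\infty]=\lambda$). *)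

theory Defs
  imports "HOL-Analysis.Analysis"
begin

(* Conventions (see NOTES.md).  A subset of the projective space P(V) is represented by
   a lift in V.  A properly convex domain P(C) is represented by an open convex cone C
   (closed under positive scaling) containing no full affine line. *)

definition proper_convex_cone :: "'a::real_normed_vector set \<Rightarrow> bool" where
  "proper_convex_cone C \<longleftrightarrow> open C \<and> convex C \<and> C \<noteq> {} \<and>
     (\<forall>x\<in>C. \<forall>t>0. t *\<^sub>R x \<in> C) \<and>
     \<not> (\<exists>p v. v \<noteq> 0 \<and> (\<forall>t::real. p + t *\<^sub>R v \<in> C))"

(* full preimage in V - {0} of P(K) *)
definition proj_lift :: "'a::real_vector set \<Rightarrow> 'a set" where
  "proj_lift K = K \<union> uminus ` K"

(* C1 + C2 inside E1 \<oplus> E2 = 'a \<times> 'b *)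
definition join_cone :: "'a::real_vector set \<Rightarrow> 'b::real_vector set \<Rightarrow> ('a \<times> 'b) set" where
  "join_cone C1 C2 = {(u, 0) + (0, w) | u w. u \<in> C1 \<and> w \<in> C2}"

(* cross ratio of four points of a projective line, given by homogeneous coordinates
   in R^2; normalized so that [0:1:lambda:infinity] = lambda *)
definition det2 :: "real \<times> real \<Rightarrow> real \<times> real \<Rightarrow> real" where
  "det2 p q = fst p * snd q - snd p * fst q"

definition cross_ratio :: "real \<times> real \<Rightarrow> real \<times> real \<Rightarrow> real \<times> real \<Rightarrow> real \<times> real \<Rightarrow> real" where
  "cross_ratio a b c d = (det2 a c * det2 b d) / (det2 a b * det2 c d)"

(* x - (hilbert_param C x y) y is the endpoint x' in the boundary of the line through x, y *)
definition hilbert_param :: "'a::real_vector set \<Rightarrow> 'a \<Rightarrow> 'a \<Rightarrow> real" where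
  "hilbert_param C x y = Sup {t. 0 \<le> t \<and> x - t *\<^sub>R y \<in> C}"

(* Hilbert metric d_Omega([x],[y]) = 1/2 log [x':x:y:y'] for lifts x, y in C, with
   x' = x - a y, y' = y - b x; the point s x + t y has homogeneous coordinates (s,t). *)
definition hilbert_dist :: "'a::real_vector set \<Rightarrow> 'a \<Rightarrow> 'a \<Rightarrow> real" where
  "hilbert_dist C x y =
     (let a = hilbert_param C x y; b = hilbert_param C y x
      in ln (cross_ratio (1, - a) (1, 0) (0, 1) (- b, 1)) / 2)"

definition set_diam :: "('a \<Rightarrow> 'a \<Rightarrow> real) \<Rightarrow> 'a set \<Rightarrow> real" where
  "set_diam \<delta> U = (if U = {} then 0 else Sup {\<delta> x y | x y. x \<in> U \<and> y \<in> U})"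

(* d-dimensional Hausdorff measure of A in the (pseudo)metric space (S, delta),
   normalized by the volume of the Euclidean unit d-ball *)
definition hausdorff_measure :: "nat \<Rightarrow> 'a set \<Rightarrow> ('a \<Rightarrow> 'a \<Rightarrow> real) \<Rightarrow> 'a set \<Rightarrow> ennreal" where
  "hausdorff_measure d S \<delta> A =
     (SUP \<epsilon>\<in>{0::real<..}. INF U\<in>{U :: nat \<Rightarrow> 'a set. A \<subseteq> (\<Union>i. U i) \<and>
          (\<forall>i. U i \<subseteq> S \<and> (\<forall>x\<in>U i. \<forall>y\<in>U i. \<delta> x y \<le> \<epsilon>))}.
        (\<Sum>i. ennreal (unit_ball_vol (real d) * (set_diam \<delta> (U i) / 2) ^ d)))"

(* Busemann measure of P(C) (d = dim P(V) = dim V - 1), on lifts A \<subseteq> C *)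
definition busemann :: "'a::euclidean_space set \<Rightarrow> 'a set \<Rightarrow> ennreal" where
  "busemann C A = hausdorff_measure (DIM('a) - 1) C (hilbert_dist C) A"

end

theory Submission
  imports Defs
begin

(* Write C = C1 x C2 for the join cone. The stretches (u, w) |-> (l u, w), l > 0, are linear
   automorphisms of C and hence Hilbert isometries. The hypothesis on Omega_1 yields a ball in
   the interior of K whose points b have (fst b, 0) in the closure of K, so the stretches with
   l >= 1 map the ball into K. Testing against functionals that separate the two factors shows
   that the images of the ball under the stretches by 9^k, k = 0, 1, 2, ..., are pairwise at
   Hilbert distance more than 1/2, while on a hyperplane disc through the ball the Hilbert
   distance dominates a multiple of the Euclidean one. Hence a cover of K by sets of Hilbert
   diameter at most 1/2 pays separately for infinitely many isometric copies of the disc, each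
   of the same positive d-dimensional content. *)

section \<open>Proper convex cones\<close>

lemma join_cone_eq_Times: "join_cone C1 C2 = C1 \<times> C2"
  unfolding join_cone_def by force

lemma proper_convex_coneD:
  assumes "proper_convex_cone C"
  shows "open C" "convex C" "C \<noteq> {}" "\<And>x t. x \<in> C \<Longrightarrow> 0 < t \<Longrightarrow> t *\<^sub>R x \<in> C"
    and "\<And>p v. v \<noteq> 0 \<Longrightarrow> \<exists>t::real. p + t *\<^sub>R v \<notin> C"
  using assms unfolding proper_convex_cone_def by blast+

lemma proper_convex_cone_Times:
  assumes C1: "proper_convex_cone C1" and C2: "proper_convex_cone C2"
  shows "proper_convex_cone (C1 \<times> C2)"
  unfolding proper_convex_cone_def
proof (intro conjI ballI allI impI)
  show "open (C1 \<times> C2)" "convex (C1 \<times> C2)" "C1 \<times> C2 \<noteq> {}"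
    using proper_convex_coneD(1-3)[OF C1] proper_convex_coneD(1-3)[OF C2]
    by (auto simp: open_Times convex_Times)
  show "t *\<^sub>R x \<in> C1 \<times> C2" if "x \<in> C1 \<times> C2" "0 < t" for x and t :: real
    using that proper_convex_coneD(4)[OF C1] proper_convex_coneD(4)[OF C2] by (cases x) auto
  show "\<not> (\<exists>p v. v \<noteq> 0 \<and> (\<forall>t::real. p + t *\<^sub>R v \<in> C1 \<times> C2))"
  proof
    assume "\<exists>p v. v \<noteq> 0 \<and> (\<forall>t::real. p + t *\<^sub>R v \<in> C1 \<times> C2)"
    then obtain p v where "v \<noteq> 0" and line: "\<And>t::real. p + t *\<^sub>R v \<in> C1 \<times> C2"
      by blast
    then consider "fst v \<noteq> 0" | "snd v \<noteq> 0"
      by (metis prod.collapse zero_prod_def)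
    then show False
    proof cases
      case 1
      then show False
        using proper_convex_coneD(5)[OF C1 1, of "fst p"] line by (auto simp: mem_Times_iff)
    next
      case 2
      then show False
        using proper_convex_coneD(5)[OF C2 2, of "snd p"] line by (auto simp: mem_Times_iff)
    qed
  qed
qed

lemma scaleR_in_closure_cone:
  fixes K :: "'a::real_normed_vector set"
  assumes "\<forall>x\<in>K. \<forall>t>0. t *\<^sub>R x \<in> K" "k \<in> closure K" "0 < t"
  shows "t *\<^sub>R k \<in> closure K"
proof -
  have "t *\<^sub>R k \<in> (*\<^sub>R) t ` closure K"
    using assms by blast
  also have "\<dots> = closure ((*\<^sub>R) t ` K)"
    by (rule closure_scaleR)
  also have "\<dots> \<subseteq> closure K"
    using assms by (intro closure_mono) auto
  finally show ?thesis .
qed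

lemma scaleR_in_interior_cone:
  fixes K :: "'a::real_normed_vector set"
  assumes "\<forall>x\<in>K. \<forall>t>0. t *\<^sub>R x \<in> K" "k \<in> interior K" "0 < t"
  shows "t *\<^sub>R k \<in> interior K"
proof -
  have "open ((*\<^sub>R) t ` interior K)" "(*\<^sub>R) t ` interior K \<subseteq> K"
    using assms interior_subset by (auto intro: open_scaling)
  then show ?thesis
    using assms interior_maximal by blast
qed

lemma closure_add_interior_cone:
  fixes K :: "'a::euclidean_space set"
  assumes cone: "\<forall>x\<in>K. \<forall>t>0. t *\<^sub>R x \<in> K" and "convex K"
    and k: "k \<in> closure K" and x: "x \<in> interior K"
  shows "k + x \<in> interior K"
proof (cases "k = x")
  case True
  then show ?thesis
    using scaleR_in_interior_cone[OF cone x, of 2] by (simp add: scaleR_2)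
next
  case False
  have "k + x = midpoint (2 *\<^sub>R x) (2 *\<^sub>R k)"
    by (simp add: midpoint_def algebra_simps)
  also have "\<dots> \<in> open_segment (2 *\<^sub>R x) (2 *\<^sub>R k)"
    using False by simp
  also have "\<dots> \<subseteq> interior K"
    using in_interior_closure_convex_segment[OF \<open>convex K\<close>]
      scaleR_in_interior_cone[OF cone x] scaleR_in_closure_cone[OF cone k] by simp
  finally show ?thesis .
qed

lemma proper_convex_cone_closure_add:
  fixes C :: "'a::euclidean_space set"
  assumes C: "proper_convex_cone C" and "k \<in> closure C" "c \<in> C"
  shows "k + c \<in> C"
  using closure_add_interior_cone[of C k c] assms proper_convex_coneD[OF C]
  by (simp add: interior_open)

lemma convex_cone_closure_of_proper:
  fixes C :: "'a::euclidean_space set"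
  assumes C: "proper_convex_cone C"
  shows "convex_cone (closure C)"
proof -
  note cone = proper_convex_coneD(4)[OF C]
  obtain c where c: "c \<in> C"
    using proper_convex_coneD(3)[OF C] by blast
  have "(\<lambda>t. t *\<^sub>R c) \<midarrow>0\<rightarrow> 0"
    by (auto intro!: tendsto_eq_intros)
  then have "((\<lambda>t. t *\<^sub>R c) \<longlongrightarrow> 0) (at_right 0)"
    by (simp add: filterlim_at_split)
  moreover have "\<forall>\<^sub>F t in at_right (0::real). t *\<^sub>R c \<in> closure C"
    using c cone closure_subset by (auto simp: eventually_at_right_field intro!: exI[of _ 1])
  ultimately have zero: "0 \<in> closure C"
    by (intro Lim_in_closed_set[of "closure C"]) auto
  have "t *\<^sub>R x \<in> closure C" if "x \<in> closure C" "0 \<le> t" for x and t :: real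
    using that zero scaleR_in_closure_cone[of C x t] cone by (cases "t = 0") auto
  moreover have "x + y \<in> closure C" if "x \<in> closure C" "y \<in> closure C" for x y
  proof -
    have "(1/2) *\<^sub>R x + (1/2) *\<^sub>R y \<in> closure C"
      using convex_closure[OF proper_convex_coneD(2)[OF C]] that unfolding convex_def by auto
    from scaleR_in_closure_cone[OF _ this, of 2] show ?thesis
      using cone by (simp add: algebra_simps)
  qed
  ultimately show ?thesis
    using zero unfolding convex_cone_iff by blast
qed

lemma proper_convex_cone_closure_pointed:
  fixes C :: "'a::euclidean_space set"
  assumes C: "proper_convex_cone C" and s: "s \<in> closure C" and ms: "- s \<in> closure C"
  shows "s = 0"
proof (rule ccontr)
  assume "s \<noteq> 0"
  obtain c where c: "c \<in> C"
    using proper_convex_coneD(3)[OF C] by blast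
  have "t *\<^sub>R s \<in> closure C" for t :: real
    using convex_cone_scaleR[OF convex_cone_closure_of_proper[OF C], of t s]
      convex_cone_scaleR[OF convex_cone_closure_of_proper[OF C], of "- t" "- s"] s ms
    by (cases "0 \<le> t") auto
  then have "c + t *\<^sub>R s \<in> C" for t :: real
    using proper_convex_cone_closure_add[OF C _ c] by (metis add.commute)
  then show False
    using proper_convex_coneD(5)[OF C \<open>s \<noteq> 0\<close>, of c] by blast
qed

lemma proper_convex_cone_zero_notin:
  fixes C :: "'a::euclidean_space set"
  assumes C: "proper_convex_cone C"
  shows "0 \<notin> C"
proof
  assume "0 \<in> C"
  then obtain e where "0 < e" "ball 0 e \<subseteq> C"
    using proper_convex_coneD(1)[OF C] open_contains_ball by blast
  obtain b :: 'a where b: "b \<in> Basis"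
    using nonempty_Basis by blast
  have "(e/2) *\<^sub>R b \<in> C" "- ((e/2) *\<^sub>R b) \<in> C"
    using \<open>0 < e\<close> \<open>ball 0 e \<subseteq> C\<close> b by (auto simp: subset_iff)
  then have "(e/2) *\<^sub>R b = 0"
    using proper_convex_cone_closure_pointed[OF C] closure_subset by blast
  then show False
    using \<open>0 < e\<close> b by simp
qed

lemma convex_cone_sum:
  assumes "convex_cone K" "finite F" "\<And>v. v \<in> F \<Longrightarrow> f v \<in> K"
  shows "sum f F \<in> K"
  using assms(2,3)
  by (induction F rule: finite_induct)
    (auto simp: convex_cone_contains_0[OF assms(1)] convex_cone_add[OF assms(1)])

lemma proper_convex_cone_zero_notin_convex_hull:
  fixes C :: "'a::euclidean_space set"
  assumes C: "proper_convex_cone C"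
  shows "0 \<notin> convex hull (closure C \<inter> sphere 0 1)"
proof
  assume "0 \<in> convex hull (closure C \<inter> sphere 0 1)"
  then obtain F u where F: "finite F" "F \<subseteq> closure C \<inter> sphere 0 1" "\<And>x. x \<in> F \<Longrightarrow> 0 \<le> u x"
    "sum u F = 1" "(\<Sum>v\<in>F. u v *\<^sub>R v) = 0"
    unfolding convex_hull_explicit by blast
  then obtain j where j: "j \<in> F" "0 < u j"
    by (smt (verit) sum_nonpos)
  have "(\<Sum>v\<in>F-{j}. u v *\<^sub>R v) \<in> closure C"
    using F(1-3) by (intro convex_cone_sum[OF convex_cone_closure_of_proper[OF C]])
      (auto intro!: convex_cone_scaleR[OF convex_cone_closure_of_proper[OF C]])
  moreover have "u j *\<^sub>R j + (\<Sum>v\<in>F-{j}. u v *\<^sub>R v) = 0"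
    using F(1,5) j(1) by (simp add: sum.remove)
  ultimately have "(1 / u j) *\<^sub>R (- (u j *\<^sub>R j)) \<in> closure C"
    using j(2) by (metis add_eq_0_iff convex_cone_closure_of_proper[OF C] convex_cone_scaleR
        less_eq_real_def zero_less_divide_1_iff)
  then have "- j \<in> closure C"
    using j(2) by simp
  moreover have "j \<in> closure C" "j \<noteq> 0"
    using F(2) j(1) by auto
  ultimately show False
    using proper_convex_cone_closure_pointed[OF C] by blast
qed

lemma proper_convex_cone_uniformly_positive:
  fixes C :: "'a::euclidean_space set"
  assumes C: "proper_convex_cone C"
  obtains w \<epsilon> where "0 < \<epsilon>" "\<And>v. v \<in> C \<Longrightarrow> \<epsilon> * norm v \<le> w \<bullet> v"
proof -
  define S where "S = closure C \<inter> sphere 0 1"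
  have "compact (convex hull S)"
    unfolding S_def by (intro compact_convex_hull closed_Int_compact) auto
  then obtain w b where "0 < b" and sep: "\<And>x. x \<in> convex hull S \<Longrightarrow> b < w \<bullet> x"
    using separating_hyperplane_closed_0[of "convex hull S"] proper_convex_cone_zero_notin_convex_hull[OF C]
    by (auto simp: S_def convex_convex_hull compact_imp_closed)
  show thesis
  proof (rule that[OF \<open>0 < b\<close>])
    fix v assume v: "v \<in> C"
    then have "0 < norm v"
      using proper_convex_cone_zero_notin[OF C] by auto
    moreover have "sgn v \<in> S"
      using v \<open>0 < norm v\<close> proper_convex_coneD(4)[OF C v, of "1 / norm v"] closure_subset
      by (auto simp: S_def sgn_div_norm norm_sgn divide_inverse_commute)
    then have "b < w \<bullet> v / norm v"
      using sep hull_subset by (fastforce simp: sgn_div_norm divide_inverse_commute)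
    ultimately show "b * norm v \<le> w \<bullet> v"
      by (simp add: field_simps)
  qed
qed

lemma proper_convex_cone_positive_functional:
  fixes C :: "'a::euclidean_space set"
  assumes C: "proper_convex_cone C"
  obtains w where "\<And>v. v \<in> C \<Longrightarrow> 0 < w \<bullet> v"
proof -
  obtain w \<epsilon> where "0 < \<epsilon>" "\<And>v. v \<in> C \<Longrightarrow> \<epsilon> * norm v \<le> w \<bullet> v"
    using proper_convex_cone_uniformly_positive[OF C] by blast
  then show thesis
    using that[of w] proper_convex_cone_zero_notin[OF C]
    by (metis less_le_trans mult_pos_pos zero_less_norm_iff)
qed

section \<open>The Hilbert distance\<close>

lemma hilbert_dist_eq:
  "hilbert_dist C x y = ln (1 / (hilbert_param C x y * hilbert_param C y x)) / 2"
  by (simp add: hilbert_dist_def cross_ratio_def det2_def Let_def)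

lemma hilbert_dist_commute: "hilbert_dist C x y = hilbert_dist C y x"
  by (simp add: hilbert_dist_eq mult.commute)

lemma hilbert_dist_linear_invariant:
  assumes "linear g" "\<And>v. g v \<in> C \<longleftrightarrow> v \<in> C"
  shows "hilbert_dist C (g x) (g y) = hilbert_dist C x y"
proof -
  have "g x - t *\<^sub>R g y = g (x - t *\<^sub>R y)" "g y - t *\<^sub>R g x = g (y - t *\<^sub>R x)" for t
    using assms(1) by (simp_all add: linear_diff linear_scale)
  then show ?thesis
    using assms(2) by (simp add: hilbert_dist_eq hilbert_param_def)
qed

lemma open_add_scaleR_mem:
  fixes x v :: "'a::real_normed_vector"
  assumes "open S" "x \<in> S"
  obtains t :: real where "0 < t" "x + t *\<^sub>R v \<in> S"
proof -
  have "((\<lambda>t. x + t *\<^sub>R v) \<longlongrightarrow> x) (at_right 0)"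
    by (auto intro!: tendsto_eq_intros)
  then have "\<forall>\<^sub>F t in at_right 0. 0 < t \<and> x + t *\<^sub>R v \<in> S"
    using assms topological_tendstoD eventually_at_right_less eventually_conj by blast
  then show thesis
    using that eventually_happens'[OF trivial_limit_at_right_real] by blast
qed

lemma hilbert_param_bounds:
  fixes C :: "'a::real_inner set"
  assumes "open C" and x: "x \<in> C" and y: "y \<in> C" and pos: "\<And>v. v \<in> C \<Longrightarrow> 0 < \<phi> \<bullet> v"
  shows "0 < hilbert_param C x y" "hilbert_param C x y \<le> (\<phi> \<bullet> x) / (\<phi> \<bullet> y)"
proof -
  define T where "T = {t. 0 \<le> t \<and> x - t *\<^sub>R y \<in> C}"
  have ub: "t \<le> (\<phi> \<bullet> x) / (\<phi> \<bullet> y)" if "t \<in> T" for t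
  proof -
    have "0 < \<phi> \<bullet> (x - t *\<^sub>R y)"
      using pos that by (auto simp: T_def)
    then show ?thesis
      using pos[OF y] by (simp add: inner_diff_right field_simps)
  qed
  have "0 \<in> T"
    using x by (simp add: T_def)
  then show "hilbert_param C x y \<le> (\<phi> \<bullet> x) / (\<phi> \<bullet> y)"
    unfolding hilbert_param_def T_def[symmetric] using ub by (intro cSup_least) auto
  obtain t where "0 < t" "x + t *\<^sub>R (- y) \<in> C"
    using open_add_scaleR_mem[OF \<open>open C\<close> x] .
  then have "t \<in> T"
    by (simp add: T_def)
  moreover have "bdd_above T"
    using ub by (auto simp: bdd_above_def)
  ultimately show "0 < hilbert_param C x y"
    unfolding hilbert_param_def T_def[symmetric] using \<open>0 < t\<close> by (meson cSup_upper less_le_trans)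
qed

lemma hilbert_dist_ge_ln_ratio:
  fixes C :: "'a::real_inner set"
  assumes "open C" "x \<in> C" "y \<in> C"
    and \<phi>: "\<And>v. v \<in> C \<Longrightarrow> 0 < \<phi> \<bullet> v" and \<psi>: "\<And>v. v \<in> C \<Longrightarrow> 0 < \<psi> \<bullet> v"
  shows "ln (((\<phi> \<bullet> y) * (\<psi> \<bullet> x)) / ((\<phi> \<bullet> x) * (\<psi> \<bullet> y))) / 2 \<le> hilbert_dist C x y"
proof -
  define a b where "a = hilbert_param C x y" and "b = hilbert_param C y x"
  have a: "0 < a" "a \<le> (\<phi> \<bullet> x) / (\<phi> \<bullet> y)" and b: "0 < b" "b \<le> (\<psi> \<bullet> y) / (\<psi> \<bullet> x)"
    using hilbert_param_bounds[OF assms(1-3) \<phi>] hilbert_param_bounds[OF assms(1,3,2) \<psi>]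
    by (auto simp: a_def b_def)
  have pos: "0 < \<phi> \<bullet> x" "0 < \<phi> \<bullet> y" "0 < \<psi> \<bullet> x" "0 < \<psi> \<bullet> y"
    using assms by auto
  have "a * b \<le> ((\<phi> \<bullet> x) / (\<phi> \<bullet> y)) * ((\<psi> \<bullet> y) / (\<psi> \<bullet> x))"
    using a b by (intro mult_mono) auto
  then have "((\<phi> \<bullet> y) * (\<psi> \<bullet> x)) / ((\<phi> \<bullet> x) * (\<psi> \<bullet> y)) \<le> 1 / (a * b)"
    using a(1) b(1) pos by (simp add: field_simps)
  then have "ln (((\<phi> \<bullet> y) * (\<psi> \<bullet> x)) / ((\<phi> \<bullet> x) * (\<psi> \<bullet> y))) \<le> ln (1 / (a * b))"
    using pos by (intro ln_mono) auto
  then show ?thesis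
    by (simp add: hilbert_dist_eq a_def b_def)
qed

lemma one_minus_divide_le_ln_divide:
  fixes a b :: real
  assumes "0 < a" "0 < b"
  shows "1 - a / b \<le> ln (b / a)"
  using ln_le_minus_one[of "a / b"] assms by (simp add: ln_div)

lemma hilbert_dist_ge_dist_tilted:
  fixes C :: "'a::euclidean_space set"
  assumes "open C" "0 \<notin> C" "0 < r" and unif: "\<And>v. v \<in> C \<Longrightarrow> 2 * r * norm v \<le> w \<bullet> v"
    and xy: "x \<in> C" "y \<in> C" and "w \<bullet> x = w \<bullet> y"
  shows "r * dist x y / (w \<bullet> y + r * norm y) / 2 \<le> hilbert_dist C x y"
proof -
  have norm_pos: "0 < r * norm v" if "v \<in> C" for v
    using that \<open>0 \<notin> C\<close> \<open>0 < r\<close> by (metis mult_pos_pos zero_less_norm_iff)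
  have w_pos: "0 < w \<bullet> v" if "v \<in> C" for v
    using unif[OF that] norm_pos[OF that] by linarith
  text \<open>Compare \<open>w\<close> with \<open>w\<close> tilted along \<open>x - y\<close>, which stays positive on \<open>C\<close>.\<close>
  define \<phi> where "\<phi> = w - r *\<^sub>R sgn (x - y)"
  have \<phi>_bounds: "w \<bullet> v - r * norm v \<le> \<phi> \<bullet> v" "\<phi> \<bullet> v \<le> w \<bullet> v + r * norm v" for v
  proof -
    have "\<bar>sgn (x - y) \<bullet> v\<bar> \<le> norm v"
      using Cauchy_Schwarz_ineq2[of "sgn (x - y)" v] by (simp add: norm_sgn split: if_splits)
    then have "\<bar>r * (sgn (x - y) \<bullet> v)\<bar> \<le> r * norm v"
      using \<open>0 < r\<close> by (simp add: abs_mult)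
    then show "w \<bullet> v - r * norm v \<le> \<phi> \<bullet> v" "\<phi> \<bullet> v \<le> w \<bullet> v + r * norm v"
      by (auto simp: \<phi>_def inner_diff_left abs_le_iff)
  qed
  have \<phi>_pos: "0 < \<phi> \<bullet> v" if "v \<in> C" for v
    using \<phi>_bounds(1)[of v] unif[OF that] norm_pos[OF that] by linarith
  have "sgn (x - y) \<bullet> (x - y) = dist x y"
    by (cases "x = y") (simp_all add: sgn_div_norm dist_norm dot_square_norm power2_eq_square)
  then have diff: "\<phi> \<bullet> y - \<phi> \<bullet> x = r * dist x y"
    using \<open>w \<bullet> x = w \<bullet> y\<close> by (simp add: \<phi>_def inner_diff_left inner_diff_right algebra_simps)
  have "0 < \<phi> \<bullet> x" "0 < \<phi> \<bullet> y"
    using \<phi>_pos xy by auto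
  then have "r * dist x y / (w \<bullet> y + r * norm y) \<le> r * dist x y / (\<phi> \<bullet> y)"
    using \<phi>_bounds(2)[of y] \<open>0 < r\<close> by (intro divide_left_mono) auto
  also have "\<dots> = 1 - (\<phi> \<bullet> x) / (\<phi> \<bullet> y)"
    using diff \<open>0 < \<phi> \<bullet> y\<close> by (simp add: field_simps)
  also have "\<dots> \<le> ln (((\<phi> \<bullet> y) * (w \<bullet> x)) / ((\<phi> \<bullet> x) * (w \<bullet> y)))"
    using one_minus_divide_le_ln_divide[OF \<open>0 < \<phi> \<bullet> x\<close> \<open>0 < \<phi> \<bullet> y\<close>] \<open>w \<bullet> x = w \<bullet> y\<close>
      w_pos[OF \<open>y \<in> C\<close>] by simp
  finally have "r * dist x y / (w \<bullet> y + r * norm y) / 2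
      \<le> ln (((\<phi> \<bullet> y) * (w \<bullet> x)) / ((\<phi> \<bullet> x) * (w \<bullet> y))) / 2"
    by (rule divide_right_mono) simp
  also have "\<dots> \<le> hilbert_dist C x y"
    using \<open>open C\<close> xy \<phi>_pos w_pos by (rule hilbert_dist_ge_ln_ratio)
  finally show ?thesis .
qed

lemma hilbert_dist_ge_dist_on_slice:
  fixes C :: "'a::euclidean_space set"
  assumes "open C" "0 \<notin> C" "0 < \<epsilon>" and unif: "\<And>v. v \<in> C \<Longrightarrow> \<epsilon> * norm v \<le> w \<bullet> v"
    and "bounded B" "B \<subseteq> C" and slice: "\<And>x. x \<in> B \<Longrightarrow> w \<bullet> x = c"
  obtains \<kappa> where "0 < \<kappa>" "\<And>x y. x \<in> B \<Longrightarrow> y \<in> B \<Longrightarrow> \<kappa> * dist x y \<le> hilbert_dist C x y"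
proof (cases "B = {}")
  case True
  show thesis
    by (rule that[of 1]) (use True in auto)
next
  case False
  obtain R where R: "\<And>x. x \<in> B \<Longrightarrow> norm x \<le> R"
    using \<open>bounded B\<close> by (auto simp: bounded_iff)
  obtain b where "b \<in> B"
    using False by blast
  then have "b \<in> C"
    using \<open>B \<subseteq> C\<close> by blast
  then have "0 < c"
    using unif[of b] slice[OF \<open>b \<in> B\<close>] \<open>0 \<notin> C\<close> \<open>0 < \<epsilon>\<close>
    by (metis less_le_trans mult_pos_pos zero_less_norm_iff)
  have "0 \<le> R"
    using R[OF \<open>b \<in> B\<close>] by (meson norm_ge_zero order_trans)
  define r where "r = \<epsilon> / 2"
  have "0 < r"
    using \<open>0 < \<epsilon>\<close> by (simp add: r_def)
  have unif_r: "2 * r * norm v \<le> w \<bullet> v" if "v \<in> C" for v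
    using unif[OF that] by (simp add: r_def)
  show thesis
  proof (rule that)
    show "0 < r / (2 * (c + r * R))"
      using \<open>0 < c\<close> \<open>0 \<le> R\<close> \<open>0 < r\<close> by (simp add: add_pos_nonneg)
    fix x y assume "x \<in> B" "y \<in> B"
    then have "x \<in> C" "y \<in> C" "w \<bullet> x = w \<bullet> y"
      using \<open>B \<subseteq> C\<close> slice by auto
    have "w \<bullet> y + r * norm y \<le> c + r * R" "0 < w \<bullet> y + r * norm y"
      using slice[OF \<open>y \<in> B\<close>] R[OF \<open>y \<in> B\<close>] \<open>0 < c\<close> \<open>0 < r\<close>
      by (auto intro: add_pos_nonneg)
    then have "r * dist x y / (c + r * R) \<le> r * dist x y / (w \<bullet> y + r * norm y)"
      using \<open>0 < r\<close> by (intro divide_left_mono) auto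
    then have "r * dist x y / (c + r * R) / 2 \<le> r * dist x y / (w \<bullet> y + r * norm y) / 2"
      by (rule divide_right_mono) simp
    also have "\<dots> \<le> hilbert_dist C x y"
      using \<open>open C\<close> \<open>0 \<notin> C\<close> \<open>0 < r\<close> unif_r \<open>x \<in> C\<close> \<open>y \<in> C\<close> \<open>w \<bullet> x = w \<bullet> y\<close>
      by (rule hilbert_dist_ge_dist_tilted)
    finally show "r / (2 * (c + r * R)) * dist x y \<le> hilbert_dist C x y"
      by (simp add: mult.commute)
  qed
qed

section \<open>Hausdorff content of hyperplane discs\<close>

definition sweep :: "'a::real_vector \<Rightarrow> 'a set \<Rightarrow> 'a set" where
  "sweep w Z = {y + s *\<^sub>R w | y s. y \<in> Z \<and> s \<in> {0..1}}"

lemma sweep_mono: "Z \<subseteq> Z' \<Longrightarrow> sweep w Z \<subseteq> sweep w Z'"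
  unfolding sweep_def by blast

lemma sweep_UN: "sweep w (\<Union>i. V i) = (\<Union>i. sweep w (V i))"
  unfolding sweep_def by blast

lemma negligible_sweep_singleton:
  fixes w z :: "'a::euclidean_space"
  assumes "2 \<le> DIM('a)"
  shows "negligible (sweep w {z})"
proof (rule negligible_subset)
  show "negligible ((+) z ` span {w})"
    using assms by (intro negligible_translation negligible_lowdim) simp
  show "sweep w {z} \<subseteq> (+) z ` span {w}"
    unfolding sweep_def by (auto intro: span_mul span_base)
qed

lemma sweep_cball_subset:
  fixes w z :: "'a::real_normed_vector"
  assumes "0 < r" "1 \<le> N" "norm w \<le> real N * r"
  shows "sweep w (cball z r) \<subseteq> (\<Union>k\<le>N. cball (z + (real k / real N) *\<^sub>R w) (2 * r))"
proof
  fix p assume "p \<in> sweep w (cball z r)"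
  then obtain y s where p: "p = y + s *\<^sub>R w" and y: "dist z y \<le> r" and s: "0 \<le> s" "s \<le> 1"
    unfolding sweep_def by auto
  define k where "k = nat \<lfloor>s * real N\<rfloor>"
  have "0 \<le> s * real N"
    using s by simp
  then have "real k \<le> s * real N" "s * real N < real k + 1"
    unfolding k_def by linarith+
  moreover have "k \<le> N"
    using s mult_left_le_one_le[of "real N" s] unfolding k_def by (simp add: nat_le_iff floor_le_iff)
  moreover have "s - real k / real N = (s * real N - real k) / real N"
    using assms(2) by (simp add: field_simps)
  ultimately have k: "k \<le> N" "\<bar>s - real k / real N\<bar> \<le> 1 / real N"
    by (auto intro!: divide_right_mono)
  have "dist p (z + (real k / real N) *\<^sub>R w) = norm ((y - z) + (s - real k / real N) *\<^sub>R w)"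
    unfolding p dist_norm by (simp add: algebra_simps)
  also have "\<dots> \<le> norm (y - z) + \<bar>s - real k / real N\<bar> * norm w"
    by (rule order_trans[OF norm_triangle_ineq]) simp
  also have "\<dots> \<le> r + (1 / real N) * (real N * r)"
    using y k(2) assms(3) by (intro add_mono mult_mono) (auto simp: dist_norm norm_minus_commute)
  also have "\<dots> = 2 * r"
    using assms(2) by simp
  finally show "p \<in> (\<Union>k\<le>N. cball (z + (real k / real N) *\<^sub>R w) (2 * r))"
    using k(1) by (auto simp: dist_commute)
qed

lemma sweep_cball_subset_balls:
  fixes w z :: "'a::real_normed_vector"
  assumes "w \<noteq> 0" "0 < r"
  obtains N where "(real N + 1) * r \<le> norm w + 2 * r"
    "sweep w (cball z r) \<subseteq> (\<Union>k\<le>N. cball (z + (real k / real N) *\<^sub>R w) (2 * r))"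
proof -
  define N where "N = nat \<lceil>norm w / r\<rceil>"
  have "0 < norm w / r"
    using assms by simp
  then have N: "1 \<le> N" "norm w / r \<le> real N" "real N \<le> norm w / r + 1"
    unfolding N_def by linarith+
  show thesis
  proof (rule that)
    show "(real N + 1) * r \<le> norm w + 2 * r"
      using N(3) \<open>0 < r\<close> by (simp add: field_simps)
    show "sweep w (cball z r) \<subseteq> (\<Union>k\<le>N. cball (z + (real k / real N) *\<^sub>R w) (2 * r))"
      using N(1,2) \<open>0 < r\<close> by (intro sweep_cball_subset) (auto simp: divide_le_eq)
  qed
qed

lemma sweep_cball_measure:
  fixes w z :: "'a::euclidean_space"
  assumes "w \<noteq> 0" "0 < r"
  obtains S where "S \<in> sets lebesgue" "sweep w (cball z r) \<subseteq> S"
    "emeasure lebesgue S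
       \<le> ennreal (unit_ball_vol DIM('a) * 2 ^ DIM('a) * (norm w + 2 * r) * r ^ (DIM('a) - 1))"
proof -
  define n where "n = DIM('a)"
  obtain N where N: "(real N + 1) * r \<le> norm w + 2 * r"
    and cover: "sweep w (cball z r) \<subseteq> (\<Union>k\<le>N. cball (z + (real k / real N) *\<^sub>R w) (2 * r))"
    using sweep_cball_subset_balls[OF assms] by blast
  have "emeasure lebesgue (\<Union>k\<le>N. cball (z + (real k / real N) *\<^sub>R w) (2 * r))
      \<le> (\<Sum>k\<le>N. emeasure lebesgue (cball (z + (real k / real N) *\<^sub>R w) (2 * r)))"
    by (intro emeasure_subadditive_finite) auto
  also have "\<dots> = (\<Sum>k\<le>N. ennreal (unit_ball_vol n * (2 * r) ^ n))"
    using emeasure_cball[of "2 * r", where 'a='a] \<open>0 < r\<close> by (simp add: n_def)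
  also have "\<dots> = ennreal ((real N + 1) * (unit_ball_vol n * (2 * r) ^ n))"
    using \<open>0 < r\<close> by (simp add: ennreal_of_nat_eq_real_of_nat ennreal_mult add.commute)
  also have "\<dots> \<le> ennreal (unit_ball_vol n * 2 ^ n * (norm w + 2 * r) * r ^ (n - 1))"
  proof (intro ennreal_leI)
    have "(real N + 1) * r * r ^ (n - 1) \<le> (norm w + 2 * r) * r ^ (n - 1)"
      using N \<open>0 < r\<close> by (intro mult_right_mono) auto
    moreover have "r ^ n = r * r ^ (n - 1)"
      using DIM_positive[where 'a='a] by (simp add: n_def power_eq_if)
    ultimately show "(real N + 1) * (unit_ball_vol n * (2 * r) ^ n)
        \<le> unit_ball_vol n * 2 ^ n * (norm w + 2 * r) * r ^ (n - 1)"
      by (simp add: power_mult_distrib mult_left_mono mult.assoc mult.left_commute)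
  qed
  finally show thesis
    using that[OF _ cover] unfolding n_def by (auto intro: sets.finite_UN)
qed

lemma sweep_small_set_measure:
  fixes w z :: "'a::euclidean_space"
  assumes "2 \<le> DIM('a)" "w \<noteq> 0" "V \<subseteq> cball z r" "0 \<le> r" "r \<le> R"
  obtains S where "S \<in> sets lebesgue" "sweep w V \<subseteq> S"
    "emeasure lebesgue S
       \<le> ennreal (unit_ball_vol DIM('a) * 2 ^ DIM('a) * (norm w + 2 * R) * r ^ (DIM('a) - 1))"
proof (cases "r = 0")
  case True
  then have "sweep w V \<subseteq> sweep w {z}"
    using assms(3) by (intro sweep_mono) auto
  moreover have "sweep w {z} \<in> null_sets lebesgue"
    using negligible_sweep_singleton[OF assms(1)] by (simp add: negligible_iff_null_sets)
  ultimately show thesis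
    using that[of "sweep w {z}"] by (metis null_setsD1 null_setsD2 zero_le)
next
  case False
  then obtain S where "S \<in> sets lebesgue" "sweep w (cball z r) \<subseteq> S"
    and S: "emeasure lebesgue S
      \<le> ennreal (unit_ball_vol DIM('a) * 2 ^ DIM('a) * (norm w + 2 * r) * r ^ (DIM('a) - 1))"
    using sweep_cball_measure[OF assms(2)] assms(4) by (metis less_eq_real_def)
  moreover have "sweep w V \<subseteq> S"
    using sweep_mono[OF assms(3)] \<open>sweep w (cball z r) \<subseteq> S\<close> by blast
  moreover have "emeasure lebesgue S
      \<le> ennreal (unit_ball_vol DIM('a) * 2 ^ DIM('a) * (norm w + 2 * R) * r ^ (DIM('a) - 1))"
    using S assms(4,5) by (elim order_trans) (auto intro!: ennreal_leI mult_right_mono mult_left_mono)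
  ultimately show thesis
    using that by blast
qed

lemma cball_subset_sweep_disc:
  fixes w q :: "'a::euclidean_space"
  assumes "w \<noteq> 0" "0 < \<rho>"
  defines "\<theta> \<equiv> min (\<rho>/3) (norm w/3)"
  shows "cball (q + (1/2) *\<^sub>R w) (\<theta>/2) \<subseteq> sweep w {x \<in> ball q \<rho>. w \<bullet> x = w \<bullet> q}"
proof
  fix p assume "p \<in> cball (q + (1/2) *\<^sub>R w) (\<theta>/2)"
  define e where "e = p - (q + (1/2) *\<^sub>R w)"
  define s where "s = (w \<bullet> p - w \<bullet> q) / (w \<bullet> w)"
  define y where "y = p - s *\<^sub>R w"
  have e: "norm e \<le> \<theta>/2"
    using \<open>p \<in> cball _ _\<close> by (simp add: e_def dist_norm norm_minus_commute)
  have w: "0 < norm w" "w \<bullet> w = (norm w)\<^sup>2"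
    using assms(1) by (simp_all add: power2_norm_eq_inner)
  have "s - 1/2 = (w \<bullet> e) / (norm w)\<^sup>2"
    using w by (simp add: s_def e_def inner_diff_right inner_add_right field_simps power2_eq_square)
  moreover have "\<bar>w \<bullet> e\<bar> \<le> norm w * (\<theta>/2)"
    using Cauchy_Schwarz_ineq2[of w e] e w(1) by (meson mult_left_mono norm_ge_zero order_trans)
  ultimately have "\<bar>s - 1/2\<bar> \<le> norm w * (\<theta>/2) / (norm w)\<^sup>2"
    by (simp add: abs_div del: times_divide_eq_right) (rule divide_right_mono; simp)
  also have "\<dots> = \<theta> / (2 * norm w)"
    using w(1) by (simp add: power2_eq_square field_simps)
  finally have "\<bar>s - 1/2\<bar> \<le> \<theta> / (2 * norm w)" .
  moreover have "\<theta> / (2 * norm w) \<le> 1/6"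
    using w(1) by (simp add: \<theta>_def field_simps)
  ultimately have s: "s \<in> {0..1}"
    by (auto simp: abs_le_iff)
  have "norm (y - q) = norm (e - (s - 1/2) *\<^sub>R w)"
    by (simp add: y_def e_def algebra_simps)
  also have "\<dots> \<le> norm e + \<bar>s - 1/2\<bar> * norm w"
    by (metis norm_scaleR norm_triangle_ineq4)
  also have "\<dots> \<le> \<theta>/2 + \<theta> / (2 * norm w) * norm w"
    using e \<open>\<bar>s - 1/2\<bar> \<le> \<theta> / (2 * norm w)\<close> by (intro add_mono mult_right_mono) auto
  also have "\<dots> < \<rho>"
    using w(1) assms(2) by (simp add: \<theta>_def)
  finally have "y \<in> ball q \<rho>"
    by (simp add: dist_norm norm_minus_commute)
  moreover have "w \<bullet> y = w \<bullet> q"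
    using w by (simp add: y_def s_def inner_diff_right)
  ultimately show "p \<in> sweep w {x \<in> ball q \<rho>. w \<bullet> x = w \<bullet> q}"
    unfolding sweep_def using s by (force simp: y_def)
qed

text \<open>Unnormalised Hausdorff content at scale \<open>R\<close>; \<open>r i\<close> bounds the diameter of \<open>V i\<close>.\<close>

definition hausdorff_content :: "nat \<Rightarrow> real \<Rightarrow> 'a::metric_space set \<Rightarrow> ennreal" where
  "hausdorff_content d R B =
     (INF (V, r)\<in>{(V :: nat \<Rightarrow> 'a set, r :: nat \<Rightarrow> real). B \<subseteq> (\<Union>i. V i) \<and>
          (\<forall>i. r i \<le> R \<and> (\<forall>x\<in>V i. \<forall>y\<in>V i. dist x y \<le> r i))}.
        \<Sum>i. if V i = {} then 0 else ennreal (r i ^ d))"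

lemma hausdorff_content_le:
  assumes "B \<subseteq> (\<Union>i. V i)" "\<And>i. r i \<le> R" "\<And>i x y. x \<in> V i \<Longrightarrow> y \<in> V i \<Longrightarrow> dist x y \<le> r i"
  shows "hausdorff_content d R B \<le> (\<Sum>i. if V i = {} then 0 else ennreal (r i ^ d))"
  unfolding hausdorff_content_def using assms by (intro INF_lower2[of "(V, r)"]) auto

lemma emeasure_subset_sweep_le:
  fixes w :: "'a::euclidean_space"
  assumes "2 \<le> DIM('a)" "w \<noteq> 0" "0 \<le> R"
    and "T \<in> sets lebesgue" "T \<subseteq> sweep w Z" "Z \<subseteq> (\<Union>i. V i)" and r: "\<And>i. r i \<le> R"
    and diam: "\<And>i x y. x \<in> V i \<Longrightarrow> y \<in> V i \<Longrightarrow> dist x y \<le> r i"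
  shows "emeasure lebesgue T \<le> ennreal (unit_ball_vol DIM('a) * 2 ^ DIM('a) * (norm w + 2 * R))
    * (\<Sum>i. if V i = {} then 0 else ennreal (r i ^ (DIM('a) - 1)))"
proof -
  define A where "A = unit_ball_vol DIM('a) * 2 ^ DIM('a) * (norm w + 2 * R)"
  define t where "t i = (if V i = {} then 0 else ennreal (r i ^ (DIM('a) - 1)))" for i
  have "0 < A"
    using assms(2,3) by (simp add: A_def add_pos_nonneg)
  have "\<exists>S. S \<in> sets lebesgue \<and> sweep w (V i) \<subseteq> S \<and> emeasure lebesgue S \<le> ennreal A * t i" for i
  proof (cases "V i = {}")
    case True
    then show ?thesis
      by (intro exI[of _ "{}"]) (simp add: sweep_def)
  next
    case False
    then obtain z where "z \<in> V i"
      by blast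
    then have "V i \<subseteq> cball z (r i)" "0 \<le> r i"
      using diam by (auto, metis dist_self)
    then obtain S where "S \<in> sets lebesgue" "sweep w (V i) \<subseteq> S"
      "emeasure lebesgue S \<le> ennreal (A * r i ^ (DIM('a) - 1))"
      using sweep_small_set_measure[OF assms(1,2)] r unfolding A_def by metis
    moreover have "ennreal (A * r i ^ (DIM('a) - 1)) = ennreal A * t i"
      using False \<open>0 < A\<close> \<open>0 \<le> r i\<close> by (simp add: t_def ennreal_mult)
    ultimately show ?thesis
      by metis
  qed
  then obtain S where S: "\<And>i. S i \<in> sets lebesgue" "\<And>i. sweep w (V i) \<subseteq> S i"
    "\<And>i. emeasure lebesgue (S i) \<le> ennreal A * t i"
    by metis
  have "T \<subseteq> (\<Union>i. S i)"
    using assms(5) sweep_mono[OF assms(6), of w] S(2) unfolding sweep_UN by blast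
  then have "emeasure lebesgue T \<le> emeasure lebesgue (\<Union>i. S i)"
    using S(1) by (intro emeasure_mono) auto
  also have "\<dots> \<le> (\<Sum>i. emeasure lebesgue (S i))"
    using S(1) by (intro emeasure_subadditive_countably) auto
  also have "\<dots> \<le> (\<Sum>i. ennreal A * t i)"
    using S(3) by (intro suminf_le) auto
  also have "\<dots> = ennreal A * (\<Sum>i. t i)"
    by simp
  finally show ?thesis
    unfolding A_def t_def .
qed

text \<open>Sweeping the disc along its normal \<open>w\<close> covers a ball, whose volume therefore bounds
  the content of the disc from below.\<close>

lemma hausdorff_content_disc_pos:
  fixes w q :: "'a::euclidean_space"
  assumes "2 \<le> DIM('a)" "w \<noteq> 0" "0 < \<rho>" "0 \<le> R"
  shows "0 < hausdorff_content (DIM('a) - 1) R {x \<in> ball q \<rho>. w \<bullet> x = w \<bullet> q}"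
proof -
  define A where "A = unit_ball_vol DIM('a) * 2 ^ DIM('a) * (norm w + 2 * R)"
  define \<theta> where "\<theta> = min (\<rho>/3) (norm w/3)"
  define M where "M = unit_ball_vol DIM('a) * (\<theta>/2) ^ DIM('a)"
  have "0 < A" "0 < M"
    using assms by (auto simp: A_def M_def \<theta>_def add_pos_nonneg)
  have "ennreal (M / A) \<le> (\<Sum>i. if V i = {} then 0 else ennreal (r i ^ (DIM('a) - 1)))"
    if "{x \<in> ball q \<rho>. w \<bullet> x = w \<bullet> q} \<subseteq> (\<Union>i. V i)" "\<forall>i. r i \<le> R"
      "\<forall>i. \<forall>x\<in>V i. \<forall>y\<in>V i. dist x y \<le> r i" for V :: "nat \<Rightarrow> 'a set" and r
  proof -
    have "ennreal M = emeasure lebesgue (cball (q + (1/2) *\<^sub>R w) (\<theta>/2))"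
      using emeasure_cball[of "\<theta>/2" "q + (1/2) *\<^sub>R w"] assms(2,3) by (simp add: M_def \<theta>_def)
    also have "\<dots> \<le> ennreal A * (\<Sum>i. if V i = {} then 0 else ennreal (r i ^ (DIM('a) - 1)))"
      unfolding A_def
    proof (rule emeasure_subset_sweep_le[OF assms(1,2,4)])
      show "cball (q + (1/2) *\<^sub>R w) (\<theta>/2) \<subseteq> sweep w {x \<in> ball q \<rho>. w \<bullet> x = w \<bullet> q}"
        unfolding \<theta>_def by (rule cball_subset_sweep_disc[OF assms(2,3)])
    qed (use that in auto)
    finally have "ennreal A * ennreal (M / A)
        \<le> ennreal A * (\<Sum>i. if V i = {} then 0 else ennreal (r i ^ (DIM('a) - 1)))"
      using \<open>0 < A\<close> \<open>0 < M\<close> by (simp add: ennreal_mult[symmetric])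
    then show ?thesis
      using \<open>0 < A\<close> by (simp add: ennreal_mult_le_mult_iff)
  qed
  then have "ennreal (M / A) \<le> hausdorff_content (DIM('a) - 1) R {x \<in> ball q \<rho>. w \<bullet> x = w \<bullet> q}"
    unfolding hausdorff_content_def by (intro INF_greatest) auto
  moreover have "0 < ennreal (M / A)"
    using \<open>0 < A\<close> \<open>0 < M\<close> by simp
  ultimately show ?thesis
    by order
qed

lemma proper_convex_cone_expanding_disc:
  fixes C :: "'a::euclidean_space set"
  assumes C: "proper_convex_cone C" and "0 < \<rho>" "ball q \<rho> \<subseteq> C" "2 \<le> DIM('a)" "0 \<le> \<epsilon>"
  obtains B \<kappa> where "B \<subseteq> ball q \<rho>" "0 < \<kappa>" "0 < hausdorff_content (DIM('a) - 1) (\<epsilon> / \<kappa>) B"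
    "\<And>x y. x \<in> B \<Longrightarrow> y \<in> B \<Longrightarrow> \<kappa> * dist x y \<le> hilbert_dist C x y"
proof -
  obtain w c where "0 < c" and unif: "\<And>v. v \<in> C \<Longrightarrow> c * norm v \<le> w \<bullet> v"
    using proper_convex_cone_uniformly_positive[OF C] by blast
  define B where "B = {x \<in> ball q \<rho>. w \<bullet> x = w \<bullet> q}"
  have "bounded B" "B \<subseteq> C" "\<And>x. x \<in> B \<Longrightarrow> w \<bullet> x = w \<bullet> q"
    using \<open>ball q \<rho> \<subseteq> C\<close> by (auto simp: B_def intro: bounded_subset[OF bounded_ball])
  with proper_convex_coneD(1)[OF C] proper_convex_cone_zero_notin[OF C] \<open>0 < c\<close> unif
  obtain \<kappa> where "0 < \<kappa>"
    and expanding: "\<And>x y. x \<in> B \<Longrightarrow> y \<in> B \<Longrightarrow> \<kappa> * dist x y \<le> hilbert_dist C x y"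
    by (rule hilbert_dist_ge_dist_on_slice) (auto intro: that)
  have "q \<in> C"
    using \<open>0 < \<rho>\<close> \<open>ball q \<rho> \<subseteq> C\<close> by auto
  then have "0 < w \<bullet> q"
    using unif[of q] proper_convex_cone_zero_notin[OF C] \<open>0 < c\<close>
    by (metis less_le_trans mult_pos_pos zero_less_norm_iff)
  then have "0 < hausdorff_content (DIM('a) - 1) (\<epsilon> / \<kappa>) B"
    unfolding B_def using assms(2,4,5) \<open>0 < \<kappa>\<close> by (intro hausdorff_content_disc_pos) auto
  moreover have "B \<subseteq> ball q \<rho>"
    by (auto simp: B_def)
  ultimately show thesis
    using that \<open>0 < \<kappa>\<close> expanding by blast
qed

section \<open>Separated copies have infinite Hausdorff measure\<close>

lemma ennreal_eq_top_if_multiples_le: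
  fixes c x :: ennreal
  assumes "0 < c" "\<And>N::nat. of_nat N * c \<le> x"
  shows "x = \<infinity>"
proof -
  have "\<infinity> = (SUP N. of_nat N) * c"
    using assms(1) by (simp add: ennreal_SUP_of_nat_eq_top)
  also have "\<dots> = (SUP N. of_nat N * c)"
    by (rule SUP_mult_right_ennreal)
  also have "\<dots> \<le> x"
    using assms(2) by (rule SUP_least)
  finally show ?thesis
    by (simp add: top_unique)
qed

lemma sum_if_at_most_one_le:
  fixes f :: ennreal
  assumes "finite A" "\<And>k j. k \<in> A \<Longrightarrow> j \<in> A \<Longrightarrow> P k \<Longrightarrow> P j \<Longrightarrow> k = j"
  shows "(\<Sum>k\<in>A. if P k then f else 0) \<le> f"
proof -
  have "card {k \<in> A. P k} \<le> Suc 0"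
    using assms by (subst card_le_Suc0_iff_eq) auto
  then have "of_nat (card {k \<in> A. P k}) * f \<le> 1 * f"
    by (intro mult_right_mono) auto
  moreover have "(\<Sum>k\<in>A. if P k then f else 0) = (\<Sum>k\<in>{k \<in> A. P k}. f)"
    using sum.inter_filter[OF assms(1), of "\<lambda>_. f" P] by simp
  ultimately show ?thesis
    by simp
qed

text \<open>A set of \<open>\<delta>\<close>-diameter at most \<open>\<epsilon>\<close> meets at most one of the copies \<open>h k ` B\<close>,
  so a cover by such sets pays for the content of \<open>B\<close> once for every copy.\<close>

lemma separated_copies_suminf_eq_top:
  fixes h :: "nat \<Rightarrow> 'c::metric_space \<Rightarrow> 'a" and \<delta> :: "'a \<Rightarrow> 'a \<Rightarrow> real"
  assumes content: "0 < hausdorff_content d (\<epsilon> / \<kappa>) B" and "0 < \<kappa>"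
    and cover: "\<And>k. h k ` B \<subseteq> (\<Union>i. U i)"
    and diam: "\<And>i x y. x \<in> U i \<Longrightarrow> y \<in> U i \<Longrightarrow> \<delta> x y \<le> D i" and "\<And>i. D i \<le> \<epsilon>"
    and separated: "\<And>k j x y. k \<noteq> j \<Longrightarrow> x \<in> B \<Longrightarrow> y \<in> B \<Longrightarrow> \<epsilon> < \<delta> (h k x) (h j y)"
    and expanding: "\<And>k x y. x \<in> B \<Longrightarrow> y \<in> B \<Longrightarrow> \<kappa> * dist x y \<le> \<delta> (h k x) (h k y)"
  shows "(\<Sum>i. ennreal (D i ^ d)) = \<infinity>"
proof -
  define V where "V k i = {x \<in> B. h k x \<in> U i}" for k i
  define f where "f i = ennreal ((D i / \<kappa>) ^ d)" for i
  have content_le: "hausdorff_content d (\<epsilon> / \<kappa>) B \<le> (\<Sum>i. if V k i = {} then 0 else f i)" for k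
    unfolding f_def
  proof (rule hausdorff_content_le)
    show "B \<subseteq> (\<Union>i. V k i)"
      using cover by (auto simp: V_def)
    show "D i / \<kappa> \<le> \<epsilon> / \<kappa>" for i
      using \<open>0 < \<kappa>\<close> \<open>D i \<le> \<epsilon>\<close> by (simp add: divide_right_mono)
    show "dist x y \<le> D i / \<kappa>" if "x \<in> V k i" "y \<in> V k i" for i x y
      using expanding[of x y k] diam[of "h k x" i "h k y"] that \<open>0 < \<kappa>\<close>
      by (auto simp: V_def pos_le_divide_eq mult.commute)
  qed
  have unique: "k = j" if "V k i \<noteq> {}" "V j i \<noteq> {}" for k j i
    using that separated[of k j] diam[of _ i] \<open>D i \<le> \<epsilon>\<close> unfolding V_def by force
  have at_most_once: "(\<Sum>k<N. if V k i = {} then 0 else f i) \<le> f i" for N i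
  proof -
    have "(\<Sum>k<N. if V k i = {} then 0 else f i) = (\<Sum>k<N. if V k i \<noteq> {} then f i else 0)"
      by (intro sum.cong) auto
    also have "\<dots> \<le> f i"
      using unique by (intro sum_if_at_most_one_le) auto
    finally show ?thesis .
  qed
  then have "of_nat N * hausdorff_content d (\<epsilon> / \<kappa>) B \<le> (\<Sum>i. f i)" for N
  proof -
    have "of_nat N * hausdorff_content d (\<epsilon> / \<kappa>) B = (\<Sum>k<N. hausdorff_content d (\<epsilon> / \<kappa>) B)"
      by simp
    also have "\<dots> \<le> (\<Sum>k<N. \<Sum>i. if V k i = {} then 0 else f i)"
      by (intro sum_mono content_le)
    also have "\<dots> = (\<Sum>i. \<Sum>k<N. if V k i = {} then 0 else f i)"
      by (rule suminf_sum[OF summableI, symmetric])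
    also have "\<dots> \<le> (\<Sum>i. f i)"
      using at_most_once by (intro suminf_le summableI)
    finally show ?thesis .
  qed
  then have "(\<Sum>i. f i) = \<infinity>"
    using content by (intro ennreal_eq_top_if_multiples_le)
  moreover have "ennreal (D i ^ d) = ennreal (\<kappa> ^ d) * f i" for i
    unfolding f_def using \<open>0 < \<kappa>\<close> by (subst ennreal_mult'[symmetric]) (auto simp: power_divide)
  ultimately show ?thesis
    using \<open>0 < \<kappa>\<close> by simp
qed

lemma set_diam_ge:
  assumes "\<And>x y. x \<in> U \<Longrightarrow> y \<in> U \<Longrightarrow> \<delta> x y \<le> \<epsilon>" "x \<in> U" "y \<in> U"
  shows "\<delta> x y \<le> set_diam \<delta> U"
proof -
  have "bdd_above {\<delta> x y | x y. x \<in> U \<and> y \<in> U}"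
    using assms(1) by (intro bdd_aboveI[of _ \<epsilon>]) blast
  then show ?thesis
    using assms(2,3) unfolding set_diam_def by (auto intro!: cSup_upper)
qed

lemma set_diam_le:
  assumes "\<And>x y. x \<in> U \<Longrightarrow> y \<in> U \<Longrightarrow> \<delta> x y \<le> \<epsilon>" "0 \<le> \<epsilon>"
  shows "set_diam \<delta> U \<le> \<epsilon>"
proof (cases "U = {}")
  case False
  then show ?thesis
    using assms(1) unfolding set_diam_def by simp (intro cSup_least; blast)
qed (simp add: set_diam_def assms(2))

lemma hausdorff_measure_eq_top_if_separated_copies:
  fixes h :: "nat \<Rightarrow> 'c::metric_space \<Rightarrow> 'a" and \<delta> :: "'a \<Rightarrow> 'a \<Rightarrow> real"
  assumes content: "0 < hausdorff_content d (\<epsilon> / \<kappa>) B" and "0 < \<kappa>" "0 < \<epsilon>"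
    and into: "\<And>k. h k ` B \<subseteq> A"
    and separated: "\<And>k j x y. k \<noteq> j \<Longrightarrow> x \<in> B \<Longrightarrow> y \<in> B \<Longrightarrow> \<epsilon> < \<delta> (h k x) (h j y)"
    and expanding: "\<And>k x y. x \<in> B \<Longrightarrow> y \<in> B \<Longrightarrow> \<kappa> * dist x y \<le> \<delta> (h k x) (h k y)"
  shows "hausdorff_measure d S \<delta> A = \<infinity>"
proof -
  have "(\<Sum>i. ennreal (unit_ball_vol (real d) * (set_diam \<delta> (U i) / 2) ^ d)) = \<infinity>"
    if "A \<subseteq> (\<Union>i. U i)" "\<forall>i. \<forall>x\<in>U i. \<forall>y\<in>U i. \<delta> x y \<le> \<epsilon>" for U
  proof -
    have "(\<Sum>i. ennreal (set_diam \<delta> (U i) ^ d)) = \<infinity>"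
    proof (rule separated_copies_suminf_eq_top[where h = h and \<delta> = \<delta>,
          OF content \<open>0 < \<kappa>\<close> _ _ _ separated expanding])
      show "h k ` B \<subseteq> (\<Union>i. U i)" for k
        using into that(1) by blast
      show "\<delta> x y \<le> set_diam \<delta> (U i)" if "x \<in> U i" "y \<in> U i" for i x y
        using set_diam_ge \<open>\<forall>i. \<forall>x\<in>U i. \<forall>y\<in>U i. \<delta> x y \<le> \<epsilon>\<close> that by metis
      show "set_diam \<delta> (U i) \<le> \<epsilon>" for i
        using set_diam_le \<open>0 < \<epsilon>\<close> that(2) by (metis less_imp_le)
    qed
    moreover have "ennreal (unit_ball_vol (real d) * (D / 2) ^ d)
        = ennreal (unit_ball_vol (real d) / 2 ^ d) * ennreal (D ^ d)" for D
      by (subst ennreal_mult'[symmetric]) (simp_all add: power_divide)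
    moreover have "unit_ball_vol (real d) \<noteq> 0"
      by (metis less_irrefl of_nat_0_le_iff unit_ball_vol_pos)
    ultimately show ?thesis
      by (simp add: ennreal_mult_top)
  qed
  then have "\<infinity> \<le> (INF U\<in>{U. A \<subseteq> (\<Union>i. U i) \<and> (\<forall>i. U i \<subseteq> S \<and> (\<forall>x\<in>U i. \<forall>y\<in>U i. \<delta> x y \<le> \<epsilon>))}.
        \<Sum>i. ennreal (unit_ball_vol (real d) * (set_diam \<delta> (U i) / 2) ^ d))"
    by (intro INF_greatest) auto
  also have "\<dots> \<le> hausdorff_measure d S \<delta> A"
    unfolding hausdorff_measure_def using \<open>0 < \<epsilon>\<close> by (intro SUP_upper2[of \<epsilon>]) auto
  finally show ?thesis
    by (simp add: top_unique)
qed

section \<open>Stretching the first factor of a join\<close>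

lemma linear_apfst_scaleR: "linear (apfst ((*\<^sub>R) l) :: 'a::real_vector \<times> 'b::real_vector \<Rightarrow> 'a \<times> 'b)"
  by (intro linearI) (auto simp: apfst_def map_prod_def scaleR_right_distrib split: prod.splits)

lemma apfst_scaleR_mem_Times:
  fixes C1 :: "'a::real_vector set" and C2 :: "'b::real_vector set"
  assumes "\<forall>x\<in>C1. \<forall>t>0. t *\<^sub>R x \<in> C1" "0 < l"
  shows "apfst ((*\<^sub>R) l) v \<in> C1 \<times> C2 \<longleftrightarrow> v \<in> C1 \<times> C2"
proof -
  have "l *\<^sub>R u \<in> C1 \<longleftrightarrow> u \<in> C1" for u
  proof
    assume "l *\<^sub>R u \<in> C1"
    then have "(1 / l) *\<^sub>R (l *\<^sub>R u) \<in> C1"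
      using assms by (meson zero_less_divide_1_iff)
    with \<open>0 < l\<close> show "u \<in> C1"
      by simp
  qed (use assms in simp)
  then show ?thesis
    by (cases v) auto
qed

lemma hilbert_dist_apfst_scaleR:
  fixes C1 :: "'a::real_vector set" and C2 :: "'b::real_vector set"
  assumes "\<forall>x\<in>C1. \<forall>t>0. t *\<^sub>R x \<in> C1" "0 < l"
  shows "hilbert_dist (C1 \<times> C2) (apfst ((*\<^sub>R) l) x) (apfst ((*\<^sub>R) l) y) = hilbert_dist (C1 \<times> C2) x y"
  by (rule hilbert_dist_linear_invariant[OF linear_apfst_scaleR apfst_scaleR_mem_Times[OF assms]])

lemma apfst_scaleR_in_interior:
  fixes K :: "('a::euclidean_space \<times> 'b::euclidean_space) set"
  assumes cone: "\<forall>x\<in>K. \<forall>t>0. t *\<^sub>R x \<in> K" and "convex K"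
    and "b \<in> interior K" "(fst b, 0) \<in> closure K" "1 \<le> l"
  shows "apfst ((*\<^sub>R) l) b \<in> interior K"
proof (cases "l = 1")
  case False
  then have "(l - 1) *\<^sub>R (fst b, 0) \<in> closure K"
    using assms by (intro scaleR_in_closure_cone[OF cone]) auto
  then have "(l - 1) *\<^sub>R (fst b, 0) + b \<in> interior K"
    using assms by (intro closure_add_interior_cone[OF cone])
  moreover have "(l - 1) *\<^sub>R (fst b, 0) + b = apfst ((*\<^sub>R) l) b"
    by (cases b) (simp add: algebra_simps)
  ultimately show ?thesis
    by simp
qed (use assms in \<open>simp add: apfst_def map_prod_def case_prod_beta\<close>)

lemma hilbert_dist_apfst_scaleR_ge:
  fixes C1 :: "'a::euclidean_space set" and C2 :: "'b::euclidean_space set"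
  assumes "open C1" "open C2" and cone: "\<forall>x\<in>C1. \<forall>t>0. t *\<^sub>R x \<in> C1"
    and w1: "\<And>v. v \<in> C1 \<Longrightarrow> 0 < w1 \<bullet> v" and w2: "\<And>v. v \<in> C2 \<Longrightarrow> 0 < w2 \<bullet> v"
    and "x \<in> C1 \<times> C2" "y \<in> C1 \<times> C2" "0 < l" "0 < m"
  shows "ln ((l * ((w1 \<bullet> fst x) / (w2 \<bullet> snd x))) / (m * ((w1 \<bullet> fst y) / (w2 \<bullet> snd y)))) / 2
      \<le> hilbert_dist (C1 \<times> C2) (apfst ((*\<^sub>R) l) x) (apfst ((*\<^sub>R) m) y)"
proof -
  have "ln ((((0, w2) \<bullet> apfst ((*\<^sub>R) m) y) * ((w1, 0) \<bullet> apfst ((*\<^sub>R) l) x)) /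
      (((0, w2) \<bullet> apfst ((*\<^sub>R) l) x) * ((w1, 0) \<bullet> apfst ((*\<^sub>R) m) y))) / 2
      \<le> hilbert_dist (C1 \<times> C2) (apfst ((*\<^sub>R) l) x) (apfst ((*\<^sub>R) m) y)"
  proof (rule hilbert_dist_ge_ln_ratio)
    show "open (C1 \<times> C2)"
      using assms by (simp add: open_Times)
    show "apfst ((*\<^sub>R) l) x \<in> C1 \<times> C2" "apfst ((*\<^sub>R) m) y \<in> C1 \<times> C2"
      using assms apfst_scaleR_mem_Times[OF cone] by blast+
    show "0 < (0, w2) \<bullet> v" "0 < (w1, 0) \<bullet> v" if "v \<in> C1 \<times> C2" for v
      using that w1 w2 by (auto simp: inner_prod_def mem_Times_iff)
  qed
  moreover have "0 < w2 \<bullet> snd x" "0 < w1 \<bullet> fst y"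
    using assms w1 w2 by (auto simp: mem_Times_iff)
  ultimately show ?thesis
    by (simp add: inner_prod_def apfst_def map_prod_def case_prod_beta field_simps)
qed

text \<open>The ratio bound on \<open>B\<close> loses a factor \<open>3\<close> while distinct stretches differ by a
  factor of at least \<open>9\<close>, so the logarithm in the lower bound stays above \<open>ln 3 > 1\<close>.\<close>

lemma apfst_scaleR_powers_separated:
  fixes C1 :: "'a::euclidean_space set" and C2 :: "'b::euclidean_space set" and w1 w2
  defines "\<phi> \<equiv> \<lambda>x. (w1 \<bullet> fst x) / (w2 \<bullet> snd x)"
  assumes "open C1" "open C2" and cone: "\<forall>x\<in>C1. \<forall>t>0. t *\<^sub>R x \<in> C1"
    and w1: "\<And>v. v \<in> C1 \<Longrightarrow> 0 < w1 \<bullet> v" and w2: "\<And>v. v \<in> C2 \<Longrightarrow> 0 < w2 \<bullet> v"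
    and "B \<subseteq> C1 \<times> C2" and ratio: "\<And>x y. x \<in> B \<Longrightarrow> y \<in> B \<Longrightarrow> \<phi> y < 3 * \<phi> x"
    and "k \<noteq> j" "x \<in> B" "y \<in> B"
  shows "1/2 < hilbert_dist (C1 \<times> C2) (apfst ((*\<^sub>R) (9 ^ k)) x) (apfst ((*\<^sub>R) (9 ^ j)) y)"
proof -
  have far: "1/2 < hilbert_dist (C1 \<times> C2) (apfst ((*\<^sub>R) (9 ^ k)) x) (apfst ((*\<^sub>R) (9 ^ j)) y)"
    if "j < k" "x \<in> B" "y \<in> B" for j k :: nat and x y
  proof -
    have xy: "x \<in> C1 \<times> C2" "y \<in> C1 \<times> C2"
      using that \<open>B \<subseteq> C1 \<times> C2\<close> by auto
    then have "0 < \<phi> x" "0 < \<phi> y"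
      using w1 w2 by (auto simp: \<phi>_def mem_Times_iff)
    have "(9::real) * 9 ^ j \<le> 9 ^ k"
      using power_increasing[of "Suc j" k "9::real"] \<open>j < k\<close> by simp
    have "3 * (9 ^ j * \<phi> y) = 9 ^ j * (3 * \<phi> y)"
      by simp
    also have "\<dots> \<le> 9 ^ j * (9 * \<phi> x)"
      using ratio[OF that(2,3)] by (intro mult_left_mono) auto
    also have "\<dots> \<le> 9 ^ k * \<phi> x"
      using mult_right_mono[OF \<open>9 * 9 ^ j \<le> 9 ^ k\<close>, of "\<phi> x"] \<open>0 < \<phi> x\<close> by simp
    finally have "3 \<le> (9 ^ k * \<phi> x) / (9 ^ j * \<phi> y)"
      using \<open>0 < \<phi> y\<close> by (simp add: pos_le_divide_eq)
    then have "ln 3 \<le> ln ((9 ^ k * \<phi> x) / (9 ^ j * \<phi> y))"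
      by (rule ln_mono) auto
    then have "1 < ln ((9 ^ k * \<phi> x) / (9 ^ j * \<phi> y))"
      using ln3_gt_1 by linarith
    moreover have "ln ((9 ^ k * \<phi> x) / (9 ^ j * \<phi> y)) / 2
        \<le> hilbert_dist (C1 \<times> C2) (apfst ((*\<^sub>R) (9 ^ k)) x) (apfst ((*\<^sub>R) (9 ^ j)) y)"
      unfolding \<phi>_def by (rule hilbert_dist_apfst_scaleR_ge[OF assms(2-6) xy]) auto
    ultimately show ?thesis
      by linarith
  qed
  show ?thesis
  proof (cases "j < k")
    case False
    then have "j > k"
      using \<open>k \<noteq> j\<close> by simp
    then show ?thesis
      using far[of k j y x] \<open>x \<in> B\<close> \<open>y \<in> B\<close> by (simp add: hilbert_dist_commute)
  qed (use far \<open>x \<in> B\<close> \<open>y \<in> B\<close> in blast)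
qed

lemma continuous_at_ratio_bounded:
  fixes f :: "'a::metric_space \<Rightarrow> real"
  assumes "isCont f q" "0 < f q"
  obtains \<rho> where "0 < \<rho>" "\<And>x y. x \<in> ball q \<rho> \<Longrightarrow> y \<in> ball q \<rho> \<Longrightarrow> f y < 3 * f x"
proof -
  obtain \<rho> where "0 < \<rho>" and sub: "f ` ball q \<rho> \<subseteq> ball (f q) (f q / 2)"
    using assms continuous_at_ball[of q f] by (metis half_gt_zero)
  have near: "f q / 2 < f x" "f x < 3 * (f q / 2)" if "x \<in> ball q \<rho>" for x
  proof -
    have "f x \<in> ball (f q) (f q / 2)"
      using sub imageI[OF that] by (rule subsetD)
    then have "\<bar>f q - f x\<bar> < f q / 2"
      by (simp add: dist_real_def)
    then show "f q / 2 < f x" "f x < 3 * (f q / 2)"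
      by linarith+
  qed
  show thesis
  proof (rule that[OF \<open>0 < \<rho>\<close>])
    fix x y assume "x \<in> ball q \<rho>" "y \<in> ball q \<rho>"
    then show "f y < 3 * f x"
      using near[of x] near[of y] by linarith
  qed
qed

lemma uminus_closure_proj_lift:
  fixes K :: "'a::real_normed_vector set"
  assumes "z \<in> closure (proj_lift K)"
  shows "- z \<in> closure (proj_lift K)"
proof -
  have "uminus ` proj_lift K = proj_lift K"
    by (force simp: proj_lift_def image_Un)
  moreover have "uminus ` closure (proj_lift K) = closure (uminus ` proj_lift K)"
    using closure_scaleR[of "-1" "proj_lift K"] by (simp add: fun_eq_iff[symmetric] comp_def)
  ultimately show ?thesis
    using assms by (metis image_eqI)
qed

lemma Pair_zero_in_closure_cone:
  fixes C1 :: "'a::euclidean_space set" and K :: "('a \<times> 'b::euclidean_space) set"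
  assumes C1: "proper_convex_cone C1" and "K \<subseteq> C1 \<times> C2" "u \<in> C1"
    and "(u, 0) \<in> closure (proj_lift K)"
  shows "(u, 0) \<in> closure K"
proof -
  have "closure (proj_lift K) = closure K \<union> uminus ` closure K"
    using closure_scaleR[of "-1" K] by (simp add: proj_lift_def closure_Un fun_eq_iff[symmetric] comp_def)
  moreover have "(u, 0) \<notin> uminus ` closure K"
  proof
    assume "(u, 0) \<in> uminus ` closure K"
    then have "(- u, 0) \<in> closure K"
      by (auto simp: image_iff minus_equation_iff)
    then have "- u \<in> closure C1"
      using closure_mono[OF \<open>K \<subseteq> C1 \<times> C2\<close>] by (auto simp: closure_Times)
    then have "u = 0"
      using proper_convex_cone_closure_pointed[OF C1] \<open>u \<in> C1\<close> closure_subset by blast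
    then show False
      using proper_convex_cone_zero_notin[OF C1] \<open>u \<in> C1\<close> by simp
  qed
  ultimately show ?thesis
    using assms(4) by blast
qed

text \<open>The hypothesis sees \<open>K\<close> and \<open>\<Omega>\<^sub>1\<close> only up to sign; intersecting with \<open>C1\<close>
  selects the sign for which the points lie in the closure of \<open>K\<close> itself.\<close>

lemma join_open_base_in_closure:
  fixes C1 :: "'a::euclidean_space set" and K :: "('a \<times> 'b::euclidean_space) set"
  assumes C1: "proper_convex_cone C1" and "K \<subseteq> C1 \<times> C2"
    and "\<exists>U. open U \<and> U \<noteq> {} \<and> U \<subseteq> proj_lift C1 \<and> (\<forall>u\<in>U. (u, 0) \<in> closure (proj_lift K))"
  obtains U where "open U" "U \<noteq> {}" "\<And>u. u \<in> U \<Longrightarrow> (u, 0) \<in> closure K"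
proof -
  obtain U where U: "open U" "U \<noteq> {}" "U \<subseteq> proj_lift C1"
    and U_closure: "\<And>u. u \<in> U \<Longrightarrow> (u, 0) \<in> closure (proj_lift K)"
    using assms(3) by blast
  define U' where "U' = (U \<union> uminus ` U) \<inter> C1"
  show thesis
  proof (rule that[of U'])
    show "open U'"
      using U(1) proper_convex_coneD(1)[OF C1] open_negations[OF U(1)]
      by (simp add: U'_def open_Int open_Un)
    obtain u where "u \<in> U"
      using U(2) by blast
    then have "u \<in> C1 \<or> - u \<in> C1" "- u \<in> uminus ` U"
      using U(3) by (auto simp: proj_lift_def)
    then show "U' \<noteq> {}"
      using \<open>u \<in> U\<close> by (auto simp: U'_def)
  next
    fix u assume "u \<in> U'"
    then have "(u, 0) \<in> closure (proj_lift K)"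
      using U_closure uminus_closure_proj_lift[of "(- u, 0)" K] by (auto simp: U'_def)
    then show "(u, 0) \<in> closure K"
      using Pair_zero_in_closure_cone[OF C1 assms(2)] \<open>u \<in> U'\<close> by (simp add: U'_def)
  qed
qed

lemma join_stretchable_ball:
  fixes C1 :: "'a::euclidean_space set" and C2 :: "'b::euclidean_space set"
    and K :: "('a \<times> 'b) set" and w1 w2
  defines "\<phi> \<equiv> \<lambda>x. (w1 \<bullet> fst x) / (w2 \<bullet> snd x)"
  assumes C1: "proper_convex_cone C1" and "K \<subseteq> C1 \<times> C2"
    and cone: "\<forall>x\<in>K. \<forall>t>0. t *\<^sub>R x \<in> K" and "convex K" and "interior K \<noteq> {}"
    and "\<exists>U. open U \<and> U \<noteq> {} \<and> U \<subseteq> proj_lift C1 \<and> (\<forall>u\<in>U. (u, 0) \<in> closure (proj_lift K))"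
    and w1: "\<And>v. v \<in> C1 \<Longrightarrow> 0 < w1 \<bullet> v" and w2: "\<And>v. v \<in> C2 \<Longrightarrow> 0 < w2 \<bullet> v"
  obtains \<rho> q where "0 < \<rho>" "ball q \<rho> \<subseteq> interior K"
    "\<And>b. b \<in> ball q \<rho> \<Longrightarrow> (fst b, 0) \<in> closure K"
    "\<And>x y. x \<in> ball q \<rho> \<Longrightarrow> y \<in> ball q \<rho> \<Longrightarrow> \<phi> y < 3 * \<phi> x"
proof -
  obtain U where U: "open U" "U \<noteq> {}" "\<And>u. u \<in> U \<Longrightarrow> (u, 0) \<in> closure K"
    using join_open_base_in_closure[OF C1 assms(3,7)] by blast
  obtain u p where "u \<in> U" "p \<in> interior K"
    using U(2) assms(6) by blast
  obtain t where "0 < t" "u + t *\<^sub>R fst p \<in> U"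
    using open_add_scaleR_mem[OF U(1) \<open>u \<in> U\<close>] .
  define q where "q = (u, 0) + t *\<^sub>R p"
  have "q \<in> interior K \<inter> fst -` U"
    using closure_add_interior_cone[OF cone \<open>convex K\<close> U(3)[OF \<open>u \<in> U\<close>]
      scaleR_in_interior_cone[OF cone \<open>p \<in> interior K\<close> \<open>0 < t\<close>]] \<open>u + t *\<^sub>R fst p \<in> U\<close>
    by (simp add: q_def)
  moreover have "open (interior K \<inter> fst -` U)"
    using U(1) by (simp add: open_Int open_vimage_fst)
  ultimately obtain \<rho>1 where "0 < \<rho>1" "ball q \<rho>1 \<subseteq> interior K \<inter> fst -` U"
    using open_contains_ball by blast
  have "q \<in> C1 \<times> C2"
    using \<open>q \<in> interior K \<inter> fst -` U\<close> interior_subset assms(3) by blast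
  then have "0 < w1 \<bullet> fst q" "0 < w2 \<bullet> snd q"
    using w1 w2 by (auto simp: mem_Times_iff)
  then have "isCont \<phi> q" "0 < \<phi> q"
    by (auto simp: \<phi>_def intro!: continuous_intros)
  then obtain \<rho>2 where "0 < \<rho>2" "\<And>x y. x \<in> ball q \<rho>2 \<Longrightarrow> y \<in> ball q \<rho>2 \<Longrightarrow> \<phi> y < 3 * \<phi> x"
    using continuous_at_ratio_bounded by blast
  show thesis
  proof (rule that[of "min \<rho>1 \<rho>2" q])
    show "0 < min \<rho>1 \<rho>2" "ball q (min \<rho>1 \<rho>2) \<subseteq> interior K"
      using \<open>0 < \<rho>1\<close> \<open>0 < \<rho>2\<close> \<open>ball q \<rho>1 \<subseteq> _\<close> by auto
    show "(fst b, 0) \<in> closure K" if "b \<in> ball q (min \<rho>1 \<rho>2)" for b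
      using that U(3) \<open>ball q \<rho>1 \<subseteq> _\<close> by auto
    show "\<phi> y < 3 * \<phi> x" if "x \<in> ball q (min \<rho>1 \<rho>2)" "y \<in> ball q (min \<rho>1 \<rho>2)" for x y
      using that \<open>\<And>x y. x \<in> ball q \<rho>2 \<Longrightarrow> y \<in> ball q \<rho>2 \<Longrightarrow> \<phi> y < 3 * \<phi> x\<close> by auto
  qed
qed

lemma join_cone_stretched_disc:
  fixes C1 :: "'a::euclidean_space set" and C2 :: "'b::euclidean_space set"
    and K :: "('a \<times> 'b) set"
  assumes C1: "proper_convex_cone C1" and C2: "proper_convex_cone C2" and K: "K \<subseteq> C1 \<times> C2"
    and cone: "\<forall>x\<in>K. \<forall>t>0. t *\<^sub>R x \<in> K" and "convex K" and "interior K \<noteq> {}"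
    and "\<exists>U. open U \<and> U \<noteq> {} \<and> U \<subseteq> proj_lift C1 \<and> (\<forall>u\<in>U. (u, 0) \<in> closure (proj_lift K))"
  obtains \<kappa> and B :: "('a \<times> 'b) set"
  where "0 < \<kappa>" "0 < hausdorff_content (DIM('a \<times> 'b) - 1) (1/2 / \<kappa>) B"
    "\<And>k. apfst ((*\<^sub>R) (9 ^ k)) ` B \<subseteq> K"
    "\<And>k j x y. k \<noteq> j \<Longrightarrow> x \<in> B \<Longrightarrow> y \<in> B \<Longrightarrow>
      1/2 < hilbert_dist (C1 \<times> C2) (apfst ((*\<^sub>R) (9 ^ k)) x) (apfst ((*\<^sub>R) (9 ^ j)) y)"
    "\<And>k x y. x \<in> B \<Longrightarrow> y \<in> B \<Longrightarrow>
      \<kappa> * dist x y \<le> hilbert_dist (C1 \<times> C2) (apfst ((*\<^sub>R) (9 ^ k)) x) (apfst ((*\<^sub>R) (9 ^ k)) y)"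
proof -
  have cone1: "\<forall>x\<in>C1. \<forall>t>0. t *\<^sub>R x \<in> C1"
    using proper_convex_coneD(4)[OF C1] by blast
  obtain w1 w2 where w1: "\<And>v. v \<in> C1 \<Longrightarrow> 0 < w1 \<bullet> v" and w2: "\<And>v. v \<in> C2 \<Longrightarrow> 0 < w2 \<bullet> v"
    using proper_convex_cone_positive_functional[OF C1] proper_convex_cone_positive_functional[OF C2]
    by metis
  obtain \<rho> q where "0 < \<rho>" "ball q \<rho> \<subseteq> interior K"
    and base: "\<And>b. b \<in> ball q \<rho> \<Longrightarrow> (fst b, 0) \<in> closure K"
    and ratio: "\<And>x y. x \<in> ball q \<rho> \<Longrightarrow> y \<in> ball q \<rho> \<Longrightarrow>
      (w1 \<bullet> fst y) / (w2 \<bullet> snd y) < 3 * ((w1 \<bullet> fst x) / (w2 \<bullet> snd x))"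
    by (rule join_stretchable_ball[OF C1 K cone \<open>convex K\<close> assms(6,7) w1 w2]) (auto intro: that)
  have "ball q \<rho> \<subseteq> C1 \<times> C2"
    using \<open>ball q \<rho> \<subseteq> interior K\<close> interior_subset K by (rule subset_trans[OF _ subset_trans])
  moreover have "2 \<le> DIM('a \<times> 'b)"
    using DIM_positive[where 'a='a] DIM_positive[where 'a='b] by (simp only: DIM_prod)
  ultimately obtain B \<kappa> where "B \<subseteq> ball q \<rho>" "0 < \<kappa>"
    and content: "0 < hausdorff_content (DIM('a \<times> 'b) - 1) (1/2 / \<kappa>) B"
    and expanding: "\<And>x y. x \<in> B \<Longrightarrow> y \<in> B \<Longrightarrow> \<kappa> * dist x y \<le> hilbert_dist (C1 \<times> C2) x y"
    using proper_convex_cone_expanding_disc[OF proper_convex_cone_Times[OF C1 C2] \<open>0 < \<rho>\<close>, of q "1/2"]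
    by auto
  have ratio_B: "(w1 \<bullet> fst y) / (w2 \<bullet> snd y) < 3 * ((w1 \<bullet> fst x) / (w2 \<bullet> snd x))"
    if "x \<in> B" "y \<in> B" for x y
    using that \<open>B \<subseteq> ball q \<rho>\<close> by (intro ratio) auto
  show thesis
  proof (rule that[OF \<open>0 < \<kappa>\<close> content])
    show "apfst ((*\<^sub>R) (9 ^ k)) ` B \<subseteq> K" for k
      using apfst_scaleR_in_interior[OF cone \<open>convex K\<close> _ base] \<open>B \<subseteq> ball q \<rho>\<close>
        \<open>ball q \<rho> \<subseteq> interior K\<close> interior_subset by fastforce
    show "1/2 < hilbert_dist (C1 \<times> C2) (apfst ((*\<^sub>R) (9 ^ k)) x) (apfst ((*\<^sub>R) (9 ^ j)) y)"
      if "k \<noteq> j" "x \<in> B" "y \<in> B" for k j x y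
      using proper_convex_coneD(1)[OF C1] proper_convex_coneD(1)[OF C2] cone1 w1 w2
        subset_trans[OF \<open>B \<subseteq> ball q \<rho>\<close> \<open>ball q \<rho> \<subseteq> C1 \<times> C2\<close>] ratio_B that
      by (rule apfst_scaleR_powers_separated)
    show "\<kappa> * dist x y \<le> hilbert_dist (C1 \<times> C2) (apfst ((*\<^sub>R) (9 ^ k)) x) (apfst ((*\<^sub>R) (9 ^ k)) y)"
      if "x \<in> B" "y \<in> B" for k x y
      using expanding[OF that] by (simp add: hilbert_dist_apfst_scaleR[OF cone1])
  qed
qed

theorem lemma5p1:
  fixes C1 :: "'a::euclidean_space set" and C2 :: "'b::euclidean_space set"
    and K :: "('a \<times> 'b) set"
  assumes "proper_convex_cone C1" and "proper_convex_cone C2"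
    and "K \<subseteq> join_cone C1 C2"
    and "\<forall>x\<in>K. \<forall>t>0. t *\<^sub>R x \<in> K"
    and "convex K"
    and "interior K \<noteq> {}"
    and "\<exists>U. open U \<and> U \<noteq> {} \<and> U \<subseteq> proj_lift C1 \<and>
           (\<forall>u\<in>U. (u, 0) \<in> closure (proj_lift K))"
  shows "busemann (join_cone C1 C2) K = \<infinity>"
proof -
  have "K \<subseteq> C1 \<times> C2"
    using assms(3) by (simp add: join_cone_eq_Times)
  then obtain \<kappa> and B :: "('a \<times> 'b) set"
    where "0 < \<kappa>" and content: "0 < hausdorff_content (DIM('a \<times> 'b) - 1) (1/2 / \<kappa>) B"
      and into: "\<And>k. apfst ((*\<^sub>R) (9 ^ k)) ` B \<subseteq> K"
      and separated: "\<And>k j x y. k \<noteq> j \<Longrightarrow> x \<in> B \<Longrightarrow> y \<in> B \<Longrightarrow>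
        1/2 < hilbert_dist (C1 \<times> C2) (apfst ((*\<^sub>R) (9 ^ k)) x) (apfst ((*\<^sub>R) (9 ^ j)) y)"
      and expanding: "\<And>k x y. x \<in> B \<Longrightarrow> y \<in> B \<Longrightarrow>
        \<kappa> * dist x y \<le> hilbert_dist (C1 \<times> C2) (apfst ((*\<^sub>R) (9 ^ k)) x) (apfst ((*\<^sub>R) (9 ^ k)) y)"
    using join_cone_stretched_disc[OF assms(1,2) _ assms(4-7)] by metis
  have "hausdorff_measure (DIM('a \<times> 'b) - 1) (C1 \<times> C2) (hilbert_dist (C1 \<times> C2)) K = \<infinity>"
    by (rule hausdorff_measure_eq_top_if_separated_copies[OF content \<open>0 < \<kappa>\<close> _ into separated expanding])
      simp_all
  then show ?thesis
    by (simp add: busemann_def join_cone_eq_Times)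
qed

end
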